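(* Let $P\subseteq\mathbb{R}^d$ be a Fano $d$-polytope. If $P$ is not a simplex, then there exists a facet $F$ of $P$ such that $$\sum_{v\in\mathcal{V}(P)\,:\,\langle\eta_F,v\rangle\ge 1}\langle\eta_F,v\rangle\le d$$ and every vertex of $P$ has integral distance at most $d$ from $F$.
   Context: A Fano $d$-polytope is a $d$-dimensional lattice polytope $P\subseteq\mathbb{R}^d$ (vertices in $\mathbb{Z}^d$) containing the origin in its interior such that the vertices of each facet of $P$ form a lattice basis of $\mathbb{Z}^d$. $\mathcal{V}(P)$ is the set of vertices of $P$. For a facet $F$ of $P$, $\eta_F\in(\mathbb{R}^d)^*$ is the unique inner normal of $F$ with $\langle\eta_F,x\rangle=-1$ for all $x\in F$ (so $\langle\eta_F,x\rangle\ge -1$ on $P$); for a Fano polytope $\eta_F$ is a primitive point of the dual lattice. The integral distance of a vertex $v$ from the facet $F$ is $\langle\eta_F,v\rangle+1$. *)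

theory Defs
  imports "HOL-Analysis.Analysis"
begin

definition int_lattice :: "(real ^ 'n) set" where
  "int_lattice = {x. \<forall>i. x $ i \<in> \<int>}"

definition vertices :: "(real ^ 'n) set \<Rightarrow> (real ^ 'n) set" where
  "vertices P = {v. v extreme_point_of P}"

definition lattice_basis :: "(real ^ 'n) set \<Rightarrow> bool" where
  "lattice_basis B \<longleftrightarrow>
     finite B \<and> B \<subseteq> int_lattice \<and>
     (\<forall>c :: real ^ 'n \<Rightarrow> int. (\<Sum>b\<in>B. of_int (c b) *\<^sub>R b) = 0 \<longrightarrow> (\<forall>b\<in>B. c b = 0)) \<and>
     (\<forall>x\<in>int_lattice. \<exists>c :: real ^ 'n \<Rightarrow> int. x = (\<Sum>b\<in>B. of_int (c b) *\<^sub>R b))"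

definition lattice_polytope :: "(real ^ 'n) set \<Rightarrow> bool" where
  "lattice_polytope P \<longleftrightarrow> polytope P \<and> vertices P \<subseteq> int_lattice"

definition fano_polytope :: "(real ^ 'n) set \<Rightarrow> bool" where
  "fano_polytope P \<longleftrightarrow>
     lattice_polytope P \<and> aff_dim P = int CARD('n) \<and> 0 \<in> interior P \<and>
     (\<forall>F. F facet_of P \<longrightarrow> lattice_basis (vertices F))"

text \<open>The dual space is identified with the space itself through the inner product, so that
  the pairing of \<open>\<eta>\<close> with \<open>x\<close> is \<open>\<eta> \<bullet> x\<close>. The description is proper for facets of
  a polytope with the origin in its interior, see \<open>facet_normal_ex1\<close> below.\<close>

definition facet_normal :: "(real ^ 'n) set \<Rightarrow> real ^ 'n" where
  "facet_normal F = (THE \<eta>. \<forall>x\<in>F. \<eta> \<bullet> x = -1)"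

definition integral_distance :: "(real ^ 'n) set \<Rightarrow> real ^ 'n \<Rightarrow> real" where
  "integral_distance F v = facet_normal F \<bullet> v + 1"

lemma facet_normal_ex1:
  fixes P :: "(real ^ 'n) set"
  assumes "polytope P" and "0 \<in> interior P" and F: "F facet_of P"
  shows "\<exists>!\<eta>. \<forall>x\<in>F. \<eta> \<bullet> x = -1"
    and "\<forall>x\<in>F. facet_normal F \<bullet> x = -1"
    and "\<forall>x\<in>P. facet_normal F \<bullet> x \<ge> -1"
proof -
  have "F exposed_face_of P"
    using assms by (simp add: exposed_face_of_polyhedron facet_of_imp_face_of
        polytope_imp_polyhedron)
  then obtain a b where P: "P \<subseteq> {x. a \<bullet> x \<le> b}" and Feq: "F = P \<inter> {x. a \<bullet> x = b}"
    by (auto simp: exposed_face_of_def)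
  have ne: "F \<noteq> {}" and dimF: "aff_dim F = aff_dim P - 1"
    using F by (auto simp: facet_of_def)
  have dimP: "aff_dim P = int CARD('n)"
    using aff_dim_nonempty_interior[of P] assms(2) by auto
  have a: "a \<noteq> 0"
  proof
    assume "a = 0"
    with ne Feq have "F = P" by auto
    with dimF show False by simp
  qed
  have "0 \<in> interior {x. a \<bullet> x \<le> b}"
    using assms(2) interior_mono[OF P] by blast
  then have b: "b > 0"
    using a by (simp add: interior_halfspace_le)
  define \<eta> where "\<eta> = (- 1 / b) *\<^sub>R a"
  have \<eta>F: "\<forall>x\<in>F. \<eta> \<bullet> x = -1"
    using b by (auto simp: Feq \<eta>_def)
  have \<eta>P: "\<forall>x\<in>P. \<eta> \<bullet> x \<ge> -1"
    using b P by (auto simp: \<eta>_def field_simps)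
  have "affine hull F \<subseteq> {x. a \<bullet> x = b}"
    by (rule hull_minimal) (auto simp: Feq affine_hyperplane)
  then have "0 \<notin> affine hull F"
    using b by auto
  then have "aff_dim (insert 0 F) = int DIM(real ^ 'n)"
    using dimF dimP by (simp add: aff_dim_insert)
  then have "affine hull (insert 0 F) = UNIV"
    using aff_dim_eq_full[of "insert 0 F"] by blast
  then have span: "span F = UNIV"
    using affine_hull_span_0[of "insert 0 F"] by (simp add: hull_inc span_insert_0)
  have uniq: "\<eta>' = \<eta>" if \<eta>': "\<forall>x\<in>F. \<eta>' \<bullet> x = -1" for \<eta>'
  proof -
    have "(\<eta>' - \<eta>) \<bullet> x = 0" if "x \<in> F" for x
      unfolding inner_diff_left by (simp only: bspec[OF \<eta>' that] bspec[OF \<eta>F that])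
    then have "(\<eta>' - \<eta>) \<bullet> (\<eta>' - \<eta>) = 0"
      using orthogonal_to_span[of "\<eta>' - \<eta>" F "\<eta>' - \<eta>"] unfolding span orthogonal_def
      by blast
    then show ?thesis
      by (metis inner_eq_zero_iff right_minus_eq)
  qed
  show "\<exists>!\<eta>. \<forall>x\<in>F. \<eta> \<bullet> x = -1"
    by (rule ex1I, rule \<eta>F, rule uniq)
  have "facet_normal F = \<eta>"
    unfolding facet_normal_def by (rule the_equality, rule \<eta>F, rule uniq)
  then show "\<forall>x\<in>F. facet_normal F \<bullet> x = -1" and "\<forall>x\<in>P. facet_normal F \<bullet> x \<ge> -1"
    using \<eta>F \<eta>P by (simp_all only:)
qed

end

theory Submission
  imports Defs
begin

text \<open>Let \<open>\<sigma>\<close> be the sum of the vertices of \<open>P\<close>, and \<open>n\<close> the dimension. The vertices of a facet \<open>F\<close>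
  contribute \<open>-n\<close> to \<open>\<eta> \<bullet> \<sigma>\<close>, where \<open>\<eta>\<close> is the normal of \<open>F\<close>, so the positive values of \<open>\<eta>\<close> on
  vertices add up to \<open>n + \<eta> \<bullet> \<sigma>\<close>. If \<open>\<sigma> \<noteq> 0\<close>, some facet has \<open>\<eta> \<bullet> \<sigma> < 0\<close> and satisfies the claim.
  If \<open>\<sigma> = 0\<close> and every facet violates the claim, then each \<open>\<eta>\<close> takes the value \<open>n\<close> at a single
  vertex \<open>v\<close> and only the values \<open>-1\<close> and \<open>0\<close> elsewhere. Comparing \<open>F\<close> with its neighbouring facets
  then forces all coordinates of \<open>v\<close> in the basis given by \<open>F\<close> to be \<open>-1\<close> and excludes vertices with
  \<open>\<eta>\<close>-value \<open>0\<close>, so \<open>P\<close> is a simplex.\<close>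

section \<open>Lattice bases and their dual bases\<close>

lemma int_lattice_inner_Ints:
  fixes x y :: "real ^ 'n"
  assumes "x \<in> int_lattice" "y \<in> int_lattice"
  shows "x \<bullet> y \<in> \<int>"
  using assms by (auto simp: int_lattice_def inner_vec_def intro!: Ints_sum Ints_mult)

text \<open>Expanding the unit vectors in \<open>B\<close> with integer coefficients gives a matrix
  whose columns are the \<open>\<phi> b\<close>; by linearity they read off coordinates of every
  real vector. Duality is the uniqueness of the coordinates of \<open>b'\<close>.\<close>

lemma lattice_basis_dual:
  fixes B :: "(real ^ 'n) set"
  assumes "lattice_basis B"
  obtains \<phi> where "\<And>b. b \<in> B \<Longrightarrow> \<phi> b \<in> int_lattice"
    and "\<And>b b'. b \<in> B \<Longrightarrow> b' \<in> B \<Longrightarrow> \<phi> b \<bullet> b' = (if b = b' then 1 else 0)"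
    and "\<And>x. x = (\<Sum>b\<in>B. (\<phi> b \<bullet> x) *\<^sub>R b)"
proof -
  have fin: "finite B" and BL: "B \<subseteq> int_lattice"
    and indep: "\<And>c b. (\<Sum>b\<in>B. of_int (c b :: int) *\<^sub>R b) = 0 \<Longrightarrow> b \<in> B \<Longrightarrow> c b = 0"
    and gen: "\<And>x. x \<in> int_lattice \<Longrightarrow> \<exists>c. x = (\<Sum>b\<in>B. of_int (c b :: int) *\<^sub>R b)"
    using assms unfolding lattice_basis_def by (auto 0 3)
  have "axis i 1 \<in> (int_lattice :: (real ^ 'n) set)" for i
    by (simp add: int_lattice_def axis_def)
  then have "\<forall>i. \<exists>c. axis i 1 = (\<Sum>b\<in>B. of_int (c b :: int) *\<^sub>R b)"
    using gen by blast
  then obtain C :: "'n \<Rightarrow> real ^ 'n \<Rightarrow> int"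
    where C: "\<And>i. axis i 1 = (\<Sum>b\<in>B. of_int (C i b) *\<^sub>R b)"
    by metis
  define \<phi> :: "real ^ 'n \<Rightarrow> real ^ 'n" where "\<phi> b = (\<chi> i. of_int (C i b))" for b
  have rep: "x = (\<Sum>b\<in>B. (\<phi> b \<bullet> x) *\<^sub>R b)" for x
  proof -
    have "x = (\<Sum>i\<in>UNIV. x $ i *\<^sub>R axis i 1)"
      using basis_expansion[of x] by (simp add: scalar_mult_eq_scaleR)
    also have "\<dots> = (\<Sum>i\<in>UNIV. \<Sum>b\<in>B. (x $ i * of_int (C i b)) *\<^sub>R b)"
      by (subst C) (simp add: scaleR_sum_right)
    also have "\<dots> = (\<Sum>b\<in>B. \<Sum>i\<in>UNIV. (x $ i * of_int (C i b)) *\<^sub>R b)"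
      by (rule sum.swap)
    also have "\<dots> = (\<Sum>b\<in>B. (\<phi> b \<bullet> x) *\<^sub>R b)"
      by (simp add: inner_vec_def \<phi>_def scaleR_sum_left mult.commute)
    finally show ?thesis .
  qed
  have lat: "\<phi> b \<in> int_lattice" for b
    by (simp add: int_lattice_def \<phi>_def)
  have dual: "\<phi> b \<bullet> b' = (if b = b' then 1 else 0)" if b: "b \<in> B" "b' \<in> B" for b b'
  proof -
    \<comment> \<open>\<open>lattice_basis\<close> gives independence for integer coefficients only.
      The floor merely changes the type: pairings of lattice points are integers.\<close>
    define c where "c a = \<lfloor>\<phi> a \<bullet> b'\<rfloor> - (if a = b' then 1 else 0)" for a
    have c: "of_int (c a) = \<phi> a \<bullet> b' - (if a = b' then 1 else 0)" for a
      using int_lattice_inner_Ints[OF lat[of a], of b'] BL b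
      by (auto simp: c_def subset_iff elim!: Ints_cases)
    have "(\<Sum>a\<in>B. of_int (c a) *\<^sub>R a)
        = (\<Sum>a\<in>B. (\<phi> a \<bullet> b') *\<^sub>R a) - (\<Sum>a\<in>B. (if a = b' then 1 else 0) *\<^sub>R a)"
      by (simp only: c scaleR_diff_left sum_subtractf)
    also have "(\<Sum>a\<in>B. (if a = b' then 1 else 0) *\<^sub>R a) = b'"
      using b fin by (subst sum.mono_neutral_right[of B "{b'}"]) auto
    finally have "c b = 0"
      using indep b rep[of b'] by simp
    then show ?thesis
      using c[of b] by auto
  qed
  from lat dual rep show ?thesis
    by (rule that)
qed

text \<open>Pairing a real linear relation with \<open>\<phi> b\<close> isolates the coefficient of
  \<open>b\<close>, so independence over the integers extends to the reals.\<close>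

lemma lattice_basis_basis:
  fixes B :: "(real ^ 'n) set"
  assumes "lattice_basis B"
  shows "span B = UNIV" and "card B = CARD('n)"
proof -
  obtain \<phi> where "\<And>b. b \<in> B \<Longrightarrow> \<phi> b \<in> int_lattice"
    and dual: "\<And>b b'. b \<in> B \<Longrightarrow> b' \<in> B \<Longrightarrow> \<phi> b \<bullet> b' = (if b = b' then 1 else 0)"
    and rep: "\<And>x. x = (\<Sum>b\<in>B. (\<phi> b \<bullet> x) *\<^sub>R b)"
    by (rule lattice_basis_dual[OF assms], rule that)
  have fin: "finite B"
    using assms by (simp add: lattice_basis_def)
  have "x \<in> span B" for x
    by (subst rep[of x]) (intro span_sum span_scale span_base)
  then show span: "span B = UNIV"
    by auto
  have "u b = 0" if "(\<Sum>b\<in>B. u b *\<^sub>R b) = 0" "b \<in> B" for u b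
  proof -
    have "0 = \<phi> b \<bullet> (\<Sum>b\<in>B. u b *\<^sub>R b)"
      by (simp add: that)
    also have "\<dots> = (\<Sum>b'\<in>B. if b = b' then u b' else 0)"
      unfolding inner_sum_right by (rule sum.cong) (auto simp: dual that)
    also have "\<dots> = u b"
      using fin that by simp
    finally show ?thesis by simp
  qed
  then have "independent B"
    using dependent_finite[OF fin] by blast
  then show "card B = CARD('n)"
    using dim_eq_card_independent[of B] span dim_span[of B] by simp
qed

section \<open>Facets of a polytope around the origin\<close>

lemma vertices_facet:
  assumes "F facet_of P"
  shows "vertices F = vertices P \<inter> F"
  using extreme_point_of_face[OF facet_of_imp_face_of[OF assms]] by (auto simp: vertices_def)

lemma finite_vertices: "polytope P \<Longrightarrow> finite (vertices P)"
  by (simp add: vertices_def finite_polyhedron_extreme_points polytope_imp_polyhedron)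

lemma polytope_convex_hull_vertices: "polytope P \<Longrightarrow> P = convex hull vertices P"
  unfolding vertices_def
  by (intro Krein_Milman_Minkowski polytope_imp_compact polytope_imp_convex)

lemma facet_normal_eqI:
  fixes P :: "(real ^ 'n) set"
  assumes "polytope P" "0 \<in> interior P" "F facet_of P" "\<And>x. x \<in> F \<Longrightarrow> \<eta> \<bullet> x = -1"
  shows "facet_normal F = \<eta>"
  using facet_normal_ex1(1,2)[OF assms(1-3)] assms(4) by blast

text \<open>The ray from the origin through \<open>x\<close> leaves \<open>P\<close> at a point of
  some facet. The normal of that facet is -1 there, hence negative along the whole ray.\<close>

lemma facet_in_direction:
  fixes P :: "(real ^ 'n) set"
  assumes P: "polytope P" and 0: "0 \<in> interior P" and x: "x \<noteq> 0"
  obtains F where "F facet_of P" "facet_normal F \<bullet> x < 0"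
proof -
  obtain d where d: "0 < d" "0 + d *\<^sub>R x \<in> frontier P"
    using ray_to_frontier[OF polytope_imp_bounded[OF P] 0 x] by metis
  have "rel_frontier P = frontier P"
    using 0 by (intro rel_frontier_nonempty_interior) auto
  with d rel_frontier_of_polyhedron[OF polytope_imp_polyhedron[OF P]]
  obtain F where F: "F facet_of P" "d *\<^sub>R x \<in> F"
    by auto
  have "d * (facet_normal F \<bullet> x) = -1"
    using facet_normal_ex1(2)[OF P 0 F(1)] F(2) by force
  then have "facet_normal F \<bullet> x < 0"
    using d(1) by (smt (verit) mult_nonneg_nonneg)
  with F(1) show ?thesis
    by (rule that)
qed

text \<open>The right-hand side is a face that omits 0, hence proper. If it were larger than
  \<open>F\<close>, its dimension would lie strictly between those of \<open>F\<close> and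
  \<open>P\<close>, which differ by 1.\<close>

lemma facet_eq_Int_hyperplane:
  fixes P :: "(real ^ 'n) set"
  assumes P: "polytope P" and 0: "0 \<in> interior P" and F: "F facet_of P"
  shows "F = P \<inter> {x. facet_normal F \<bullet> x = -1}"
proof (rule ccontr)
  let ?H = "P \<inter> {x. facet_normal F \<bullet> x = -1}"
  assume ne: "F \<noteq> ?H"
  have H: "?H face_of P"
    using facet_normal_ex1(3)[OF assms]
    by (intro face_of_Int_supporting_hyperplane_ge polytope_imp_convex P) auto
  have sub: "F \<subseteq> ?H"
    using facet_normal_ex1(2)[OF assms] facet_of_imp_subset[OF F] by auto
  have "F face_of ?H"
    using face_of_subset[OF facet_of_imp_face_of[OF F] sub] by auto
  then have "aff_dim F < aff_dim ?H"
    using ne face_of_imp_convex[OF H] by (intro face_of_aff_dim_lt)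
  moreover have "0 \<in> P" "0 \<notin> ?H"
    using 0 interior_subset by auto
  then have "?H \<noteq> P"
    by blast
  then have "aff_dim ?H < aff_dim P"
    using H polytope_imp_convex[OF P] by (intro face_of_aff_dim_lt)
  ultimately show False
    using F by (simp add: facet_of_def)
qed

text \<open>The neighbouring facet is reached by rotating \<open>F\<close> about the ridge opposite \<open>e\<close> until a new
  vertex is hit.\<close>

lemma neighbour_facet:
  fixes P :: "(real ^ 'n) set"
  assumes P: "polytope P" and 0: "0 \<in> interior P" and F: "F facet_of P"
    and span: "span (vertices F) = UNIV" and e: "e \<in> vertices F" and pos: "\<phi> \<bullet> e > 0"
    and ridge: "\<And>b. b \<in> vertices F - {e} \<Longrightarrow> \<phi> \<bullet> b = 0"
  obtains G t x where "G facet_of P" "facet_normal G = facet_normal F + t *\<^sub>R \<phi>" "t > 0"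
    "x \<in> vertices P" "\<phi> \<bullet> x < 0" "facet_normal G \<bullet> x = -1"
proof -
  define \<eta> where "\<eta> = facet_normal F"
  note \<eta>F = facet_normal_ex1(2)[OF P 0 F, folded \<eta>_def]
  note \<eta>P = facet_normal_ex1(3)[OF P 0 F, folded \<eta>_def]
  have VF: "vertices F = vertices P \<inter> F"
    by (rule vertices_facet[OF F])
  have VP: "vertices P \<subseteq> P"
    by (auto simp: vertices_def extreme_point_of_def)
  define N where "N = {x \<in> vertices P. \<phi> \<bullet> x < 0}"
  have finN: "finite N"
    using finite_vertices[OF P] by (simp add: N_def)
  \<comment> \<open>A nonzero functional that is nonnegative at all vertices is nonnegative on
    \<open>P\<close>, which is impossible around an interior origin.\<close>
  have neN: "N \<noteq> {}"
  proof
    assume "N = {}"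
    then have "vertices P \<subseteq> {x. \<phi> \<bullet> x \<ge> 0}"
      by (auto simp: N_def not_less)
    then have "P \<subseteq> {x. \<phi> \<bullet> x \<ge> 0}"
      by (subst polytope_convex_hull_vertices[OF P])
        (intro hull_minimal convex_halfspace_ge)
    then have "0 \<in> interior {x. \<phi> \<bullet> x \<ge> 0}"
      using 0 interior_mono by blast
    moreover have "\<phi> \<noteq> 0"
      using pos by auto
    ultimately show False
      by (simp add: interior_halfspace_ge)
  qed
  \<comment> \<open>\<open>r x\<close> is the parameter at which
    \<open>\<eta> + t *\<^sub>R \<phi>\<close> drops to -1 at \<open>x\<close>. The minimum over
    \<open>N\<close> is the first such event, so no vertex falls below -1.\<close>
  define r where "r x = (1 + \<eta> \<bullet> x) / (- (\<phi> \<bullet> x))" for x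
  define t where "t = Min (r ` N)"
  have "t \<in> r ` N" and tmin: "\<And>x. x \<in> N \<Longrightarrow> t \<le> r x"
    using finN neN by (auto simp: t_def)
  then obtain x where x: "x \<in> N" "t = r x"
    by auto
  have xP: "x \<in> P" "x \<in> vertices P" "\<phi> \<bullet> x < 0"
    using x VP by (auto simp: N_def)
  have tight: "(\<eta> + t *\<^sub>R \<phi>) \<bullet> x = -1"
    using xP by (simp add: x(2) r_def inner_add_left inner_diff_left)
  \<comment> \<open>On the vertices of \<open>F\<close> the functional \<open>\<phi>\<close> is zero
    or positive, so no point of \<open>N\<close> lies on \<open>F\<close>. This makes
    \<open>t\<close> strictly positive.\<close>
  have less: "-1 < \<eta> \<bullet> x" if "x \<in> N" for x
  proof (rule ccontr)
    assume "\<not> ?thesis"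
    with \<eta>P that VP have eq: "\<eta> \<bullet> x = -1"
      by (force simp: N_def)
    have "x \<in> F"
      using that VP eq by (subst facet_eq_Int_hyperplane[OF P 0 F]) (auto simp: N_def \<eta>_def)
    then have "x \<in> vertices F"
      using that by (auto simp: VF N_def)
    with ridge pos that show False
      by (cases "x = e") (auto simp: N_def)
  qed
  have tpos: "t > 0"
    using less[OF x(1)] xP unfolding x(2) r_def by (intro divide_pos_pos) auto
  define G where "G = P \<inter> {y. (\<eta> + t *\<^sub>R \<phi>) \<bullet> y = -1}"
  have ge: "(\<eta> + t *\<^sub>R \<phi>) \<bullet> y \<ge> -1" if "y \<in> P" for y
  proof -
    have "(\<eta> + t *\<^sub>R \<phi>) \<bullet> y \<ge> -1" if y: "y \<in> vertices P" for y
    proof (cases "y \<in> N")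
      case True
      then have "t \<le> (1 + \<eta> \<bullet> y) / (- (\<phi> \<bullet> y))" "\<phi> \<bullet> y < 0"
        using tmin by (auto simp: r_def N_def)
      then show ?thesis
        by (simp add: inner_add_left field_simps)
    next
      case False
      then have "t * (\<phi> \<bullet> y) \<ge> 0" "\<eta> \<bullet> y \<ge> -1"
        using y tpos \<eta>P VP by (auto simp: N_def)
      then show ?thesis
        by (simp add: inner_add_left)
    qed
    then have "P \<subseteq> {y. (\<eta> + t *\<^sub>R \<phi>) \<bullet> y \<ge> -1}"
      by (subst polytope_convex_hull_vertices[OF P])
        (intro hull_minimal convex_halfspace_ge, auto)
    then show ?thesis
      using that by auto
  qed
  have "G face_of P"
    unfolding G_def by (intro face_of_Int_supporting_hyperplane_ge polytope_imp_convex P ge)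
  moreover have xG: "x \<in> G"
    using xP tight by (simp add: G_def)
  \<comment> \<open>An exchange argument: \<open>\<phi>\<close> vanishes on the ridge but not at
    \<open>x\<close>, so replacing \<open>e\<close> by \<open>x\<close> in \<open>vertices F\<close>
    keeps a spanning set, now inside \<open>G\<close>. As 0 is off the affine hull of
    \<open>G\<close>, the affine dimension is one less than that of the space.\<close>
  moreover have "aff_dim G = aff_dim P - 1"
  proof -
    have ridgeG: "vertices F - {e} \<subseteq> G"
      using \<eta>F ridge VP by (auto simp: G_def VF inner_add_left)
    have "vertices F - {e} \<subseteq> {y. \<phi> \<bullet> y = 0}"
      using ridge by auto
    then have "span (vertices F - {e}) \<subseteq> {y. \<phi> \<bullet> y = 0}"
      by (intro span_minimal subspace_hyperplane)
    then have "e \<in> span (insert x (vertices F - {e}))"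
      using xP span by (intro in_span_delete) auto
    moreover have "insert x (vertices F - {e}) \<subseteq> G"
      using ridgeG xG by auto
    ultimately have "e \<in> span G" "vertices F \<subseteq> insert e G"
      using span_mono ridgeG by blast+
    then have "vertices F \<subseteq> span G"
      using span_superset by blast
    then have "span G = UNIV"
      using span span_minimal[of "vertices F" "span G"] by auto
    then have "dim (insert 0 G) = CARD('n)"
      by (metis span_insert_0 dim_span dim_UNIV DIM_cart DIM_real mult.right_neutral)
    then have "aff_dim (insert 0 G) = int CARD('n)"
      by (simp add: aff_dim_zero hull_inc)
    moreover have "aff_dim P = int CARD('n)"
      using aff_dim_nonempty_interior[of P] 0 by auto
    moreover have "0 \<notin> affine hull G"
    proof -
      have "affine hull G \<subseteq> {y. (\<eta> + t *\<^sub>R \<phi>) \<bullet> y = -1}"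
        by (rule hull_minimal) (auto simp: G_def affine_hyperplane)
      then show ?thesis by auto
    qed
    ultimately show ?thesis
      by (simp add: aff_dim_insert)
  qed
  ultimately have G: "G facet_of P"
    by (auto simp: facet_of_def)
  have nG: "facet_normal G = \<eta> + t *\<^sub>R \<phi>"
    using P 0 G by (rule facet_normal_eqI) (simp add: G_def)
  show ?thesis
    using that[OF G _ tpos xP(2,3)] nG tight \<eta>_def by simp
qed

section \<open>Facet normals of Fano polytopes\<close>

lemma fano_polytopeD:
  fixes P :: "(real ^ 'n) set"
  assumes "fano_polytope P"
  shows "polytope P" "0 \<in> interior P" "vertices P \<subseteq> int_lattice"
    "F facet_of P \<Longrightarrow> lattice_basis (vertices F)"
  using assms by (auto simp: fano_polytope_def lattice_polytope_def)

lemma facet_normal_inner_eq_sum: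
  fixes P :: "(real ^ 'n) set"
  assumes "polytope P" "0 \<in> interior P" "F facet_of P"
    and rep: "x = (\<Sum>b\<in>vertices F. c b *\<^sub>R b)"
  shows "facet_normal F \<bullet> x = - (\<Sum>b\<in>vertices F. c b)"
proof -
  have "facet_normal F \<bullet> b = -1" if "b \<in> vertices F" for b
    using that facet_normal_ex1(2)[OF assms(1-3)] vertices_facet[OF assms(3)] by auto
  then have "facet_normal F \<bullet> x = (\<Sum>b\<in>vertices F. - c b)"
    by (simp add: rep inner_sum_right)
  then show ?thesis
    by (simp add: sum_negf)
qed

text \<open>The normal is minus the coordinate sum in the lattice basis \<open>vertices F\<close>,
  where lattice points have integer coordinates.\<close>

lemma facet_normal_inner_Ints:
  fixes P :: "(real ^ 'n) set"
  assumes P: "fano_polytope P" and F: "F facet_of P" and x: "x \<in> int_lattice"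
  shows "facet_normal F \<bullet> x \<in> \<int>"
proof -
  obtain c where "x = (\<Sum>b\<in>vertices F. of_int (c b :: int) *\<^sub>R b)"
    using fano_polytopeD(4)[OF P F] x unfolding lattice_basis_def by blast
  from facet_normal_inner_eq_sum[OF fano_polytopeD(1,2)[OF P] F this] show ?thesis
    by (metis Ints_minus Ints_of_int of_int_sum)
qed

text \<open>By integrality every vertex has value -1, 0 or at least 1. The value -1 occurs exactly
  at the vertices of \<open>F\<close>, one for each dimension.\<close>

lemma sum_vertices_facet_normal:
  fixes P :: "(real ^ 'n) set"
  assumes P: "fano_polytope P" and F: "F facet_of P"
  shows "(\<Sum>v \<in> {v \<in> vertices P. facet_normal F \<bullet> v \<ge> 1}. facet_normal F \<bullet> v)
    = real CARD('n) + facet_normal F \<bullet> (\<Sum>v \<in> vertices P. v)"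
proof -
  note P' = fano_polytopeD[OF P]
  let ?\<eta> = "facet_normal F" and ?V = "vertices P"
  let ?S = "{v \<in> ?V. ?\<eta> \<bullet> v \<ge> 1}"
  have fin: "finite ?V"
    using P' by (simp add: finite_vertices)
  have VF: "vertices F \<subseteq> ?V" "\<And>v. v \<in> vertices F \<Longrightarrow> ?\<eta> \<bullet> v = -1"
    using facet_normal_ex1(2)[OF P'(1,2) F] vertices_facet[OF F] by auto
  have zero: "?\<eta> \<bullet> v = 0" if v: "v \<in> ?V" "v \<notin> vertices F" "v \<notin> ?S" for v
  proof -
    have "v \<in> P"
      using v by (auto simp: vertices_def extreme_point_of_def)
    then have "?\<eta> \<bullet> v \<ge> -1" "?\<eta> \<bullet> v \<noteq> -1"
      using v vertices_facet[OF F] facet_eq_Int_hyperplane[OF P'(1,2) F]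
        facet_normal_ex1(3)[OF P'(1,2) F] by auto
    moreover have "?\<eta> \<bullet> v < 1"
      using v by auto
    moreover have "?\<eta> \<bullet> v \<in> \<int>"
      using facet_normal_inner_Ints[OF P F] P'(3) v by auto
    ultimately show ?thesis
      by (auto elim!: Ints_cases)
  qed
  have "?\<eta> \<bullet> (\<Sum>v\<in>?V. v) = (\<Sum>v\<in>?V. ?\<eta> \<bullet> v)"
    by (simp add: inner_sum_right)
  also have "\<dots> = (\<Sum>v\<in>vertices F \<union> ?S. ?\<eta> \<bullet> v)"
    using fin VF zero by (intro sum.mono_neutral_right) auto
  also have "\<dots> = (\<Sum>v\<in>vertices F. ?\<eta> \<bullet> v) + (\<Sum>v\<in>?S. ?\<eta> \<bullet> v)"
    using fin VF by (intro sum.union_disjoint) (auto intro: finite_subset)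
  also have "(\<Sum>v\<in>vertices F. ?\<eta> \<bullet> v) = - real CARD('n)"
    using VF(2) lattice_basis_basis(2)[OF P'(4)[OF F]] by simp
  finally show ?thesis by simp
qed

section \<open>The extremal case\<close>

lemma extremal_fano_polytope_simplex:
  fixes P :: "(real ^ 'n) set"
  assumes P: "fano_polytope P"
    and extremal: "\<And>F. F facet_of P \<Longrightarrow> \<exists>v\<in>vertices P. facet_normal F \<bullet> v = real CARD('n) \<and>
      (\<forall>x\<in>vertices P - {v}. facet_normal F \<bullet> x \<in> {-1, 0})"
  shows "int CARD('n) simplex P"
proof -
  note P' = fano_polytopeD[OF P]
  define n where "n = real CARD('n)"
  have n1: "n \<ge> 1"
    by (simp add: n_def Suc_leI)
  have val: "facet_normal G \<bullet> x \<in> {-1, 0, n}" if "G facet_of P" "x \<in> vertices P" for G x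
    using extremal[OF that(1)] that(2) by (auto simp: n_def)
  have ex_facet: "\<exists>F. F facet_of P \<and> facet_normal F \<bullet> x < 0" if "x \<noteq> 0" for x
    using facet_in_direction[OF P'(1,2) that] by metis
  \<comment> \<open>Any nonzero vector serves here; only the existence of a facet matters.\<close>
  obtain F where F: "F facet_of P"
    using ex_facet[of "axis undefined 1"] by (auto simp: axis_eq_0_iff)
  define \<eta> where "\<eta> = facet_normal F"
  define V where "V = vertices F"
  have basis: "lattice_basis V"
    using P'(4)[OF F] by (simp add: V_def)
  have finV: "finite V" and cardV: "real (card V) = n" and spanV: "span V = UNIV"
    using basis lattice_basis_basis[OF basis] by (auto simp: lattice_basis_def n_def)
  have VP: "V = vertices P \<inter> F"
    using vertices_facet[OF F] by (simp add: V_def)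
  obtain \<phi> where \<phi>: "\<And>b. b \<in> V \<Longrightarrow> \<phi> b \<in> int_lattice"
    and dual: "\<And>b b'. b \<in> V \<Longrightarrow> b' \<in> V \<Longrightarrow> \<phi> b \<bullet> b' = (if b = b' then 1 else 0)"
    and rep: "\<And>x. x = (\<Sum>b\<in>V. (\<phi> b \<bullet> x) *\<^sub>R b)"
    by (rule lattice_basis_dual[OF basis], rule that)
  have \<eta>_sum: "\<eta> \<bullet> x = - (\<Sum>b\<in>V. \<phi> b \<bullet> x)" for x
    unfolding \<eta>_def V_def
    by (rule facet_normal_inner_eq_sum[OF P'(1,2) F rep[unfolded V_def]])
  have \<eta>V: "\<eta> \<bullet> b = -1" if "b \<in> V" for b
    using facet_normal_ex1(2)[OF P'(1,2) F] that by (auto simp: VP \<eta>_def)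
  have \<eta>V': "b \<in> V" if "b \<in> vertices P" "\<eta> \<bullet> b = -1" for b
  proof -
    have "b \<in> P"
      using that by (auto simp: vertices_def extreme_point_of_def)
    then have "b \<in> F"
      using that by (subst facet_eq_Int_hyperplane[OF P'(1,2) F]) (simp add: \<eta>_def)
    then show ?thesis
      using that by (simp add: VP)
  qed
  have \<phi>_int: "\<phi> b \<bullet> x \<in> \<int>" if "b \<in> V" "x \<in> vertices P" for b x
    using \<phi> P'(3) that by (auto intro: int_lattice_inner_Ints)
  obtain v where v: "v \<in> vertices P" "\<eta> \<bullet> v = n"
    and others: "\<And>x. x \<in> vertices P \<Longrightarrow> x \<noteq> v \<Longrightarrow> \<eta> \<bullet> x = -1 \<or> \<eta> \<bullet> x = 0"
    using extremal[OF F] by (auto simp: \<eta>_def n_def)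

  txt \<open>Here \<open>\<eta> + t *\<^sub>R \<phi> b\<close> is the normal of the facet adjacent to \<open>F\<close> opposite \<open>b\<close>; its value
    \<open>t - 1\<close> at \<open>b\<close> must be \<open>0\<close> or \<open>n\<close>.\<close>

  have step: "\<exists>t. (t = 1 \<and> \<phi> b \<bullet> v \<in> {0, -n, -n-1} \<or> t = n + 1 \<and> \<phi> b \<bullet> v = -1) \<and>
      (\<forall>y\<in>vertices P. \<eta> \<bullet> y + t * (\<phi> b \<bullet> y) \<in> {-1, 0, n})" if b: "b \<in> V" for b
  proof -
    obtain G t x where G: "G facet_of P" and nG: "facet_normal G = \<eta> + t *\<^sub>R \<phi> b" and t: "t > 0"
      and x: "x \<in> vertices P" "\<phi> b \<bullet> x < 0" "facet_normal G \<bullet> x = -1"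
      by (rule neighbour_facet[OF P'(1,2) F, of b "\<phi> b"])
        (use spanV b dual in \<open>auto simp: V_def \<eta>_def\<close>)
    have valG: "\<eta> \<bullet> y + t * (\<phi> b \<bullet> y) \<in> {-1, 0, n}" if "y \<in> vertices P" for y
      using val[OF G that] by (simp add: nG inner_add_left)
    have "\<eta> \<bullet> b + t * (\<phi> b \<bullet> b) \<in> {-1, 0, n}"
      using b by (intro valG) (simp add: VP)
    then have t_cases: "t = 1 \<or> t = n + 1"
      using t b by (auto simp: \<eta>V dual)
    have eqx: "\<eta> \<bullet> x + t * (\<phi> b \<bullet> x) = -1"
      using x(3) by (simp add: nG inner_add_left)
    have neg: "t * (\<phi> b \<bullet> x) < 0"
      using t x(2) by (simp add: mult_pos_neg)
    obtain k where k: "\<phi> b \<bullet> x = of_int k"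
      using \<phi>_int[OF b x(1)] by (auto elim: Ints_cases)
    then have k1: "k \<le> -1"
      using x(2) by simp
    have "t = 1 \<and> \<phi> b \<bullet> v \<in> {0, -n, -n-1} \<or> t = n + 1 \<and> \<phi> b \<bullet> v = -1"
    proof (cases "t = 1")
      case True
      then show ?thesis
        using valG[OF v(1)] v(2) by auto
    next
      case False
      then have t': "t = n + 1"
        using t_cases by simp
      \<comment> \<open>For another vertex \<eta> is -1 or 0, so the new normal equals -1 at
        \<open>x\<close> only if \<open>t * of_int k\<close> is 0 or -1. The former is excluded by
        \<open>neg\<close>, the latter because the product is at most -(n + 1).\<close>
      have "x = v"
      proof (rule ccontr)
        assume "x \<noteq> v"
        with others x(1) neg eqx have "t * of_int k = -1"
          by (force simp: k)
        moreover have "t * of_int k \<le> t * (-1)"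
          using k1 t by (intro mult_left_mono) auto
        ultimately show False
          using t' n1 by simp
      qed
      then have "(n + 1) * (\<phi> b \<bullet> v) = (n + 1) * (-1)"
        using eqx v(2) t' by simp
      then show ?thesis
        using n1 t' by (simp only: mult_cancel_left) simp
    qed
    with valG show ?thesis
      by blast
  qed

  have v_sum: "(\<Sum>b\<in>V. \<phi> b \<bullet> v) = -n"
    using \<eta>_sum[of v] v(2) by simp
  have v_nonpos: "\<phi> b \<bullet> v \<le> 0" if "b \<in> V" for b
    using step[OF that] n1 by auto
  \<comment> \<open>The coordinates of \<open>v\<close> are nonpositive with sum -n, so none can be
    -n - 1.\<close>
  have v_ge: "\<phi> b \<bullet> v \<ge> -n" if "b \<in> V" for b
  proof -
    have "(\<Sum>b'\<in>V - {b}. \<phi> b' \<bullet> v) \<le> 0"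
      using v_nonpos by (intro sum_nonpos) auto
    then show ?thesis
      using v_sum sum.remove[OF finV that, of "\<lambda>b. \<phi> b \<bullet> v"] by simp
  qed
  have v_coord: "\<phi> b \<bullet> v = -1" if n2: "n \<noteq> 1" and b: "b \<in> V" for b
  proof -
    \<comment> \<open>A coordinate -n would exhaust the sum and give
      \<open>v = (-n) *\<^sub>R b\<close>. A facet whose normal is -1 at \<open>v\<close> then has
      the value 1/n at \<open>b\<close>, which is none of -1, 0, n unless n = 1.\<close>
    have ne: "\<phi> b \<bullet> v \<noteq> -n" if b: "b \<in> V" for b
    proof
      assume eq: "\<phi> b \<bullet> v = -n"
      then have "(\<Sum>b'\<in>V - {b}. - (\<phi> b' \<bullet> v)) = 0"
        using v_sum sum.remove[OF finV b, of "\<lambda>b. \<phi> b \<bullet> v"] by (simp add: sum_negf)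
      then have "\<forall>b'\<in>V - {b}. - (\<phi> b' \<bullet> v) = 0"
        using finV v_nonpos by (subst (asm) sum_nonneg_eq_0_iff) auto
      then have "(\<Sum>b'\<in>V - {b}. (\<phi> b' \<bullet> v) *\<^sub>R b') = 0"
        by (intro sum.neutral) auto
      then have vb: "v = (-n) *\<^sub>R b"
        using rep[of v] sum.remove[OF finV b, of "\<lambda>b. (\<phi> b \<bullet> v) *\<^sub>R b"] eq by simp
      have "v \<noteq> 0"
        using v(2) n1 by auto
      then obtain G where G: "G facet_of P" "facet_normal G \<bullet> v < 0"
        using ex_facet by blast
      then have "facet_normal G \<bullet> v = -1"
        using val[OF G(1) v(1)] n1 by auto
      then have "n * (facet_normal G \<bullet> b) = 1"
        by (simp add: vb)
      moreover have "facet_normal G \<bullet> b \<in> {-1, 0, n}"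
        using b by (intro val[OF G(1)]) (simp add: VP)
      ultimately have "n * n = 1"
        using n1 by auto
      then show False
        using n1 n2 by (simp add: square_eq_1_iff)
    qed
    \<comment> \<open>Only the coordinates 0 and -1 remain. There are n of them with sum -n, so all
      are -1.\<close>
    have ge: "0 \<le> \<phi> b \<bullet> v + 1" if "b \<in> V" for b
      using step[OF that] v_ge[OF that] ne[OF that] by auto
    have "(\<Sum>b\<in>V. \<phi> b \<bullet> v + 1) = 0"
      using v_sum cardV by (simp add: sum.distrib)
    then have "\<phi> b \<bullet> v + 1 = 0"
      using finV ge b by (subst (asm) sum_nonneg_eq_0_iff) auto
    then show ?thesis by simp
  qed

  have "vertices P \<subseteq> insert v V"
  proof
    fix w assume w: "w \<in> vertices P"
    show "w \<in> insert v V"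
    proof (rule ccontr)
      assume "w \<notin> insert v V"
      then have \<eta>w: "\<eta> \<bullet> w = 0"
        using others \<eta>V' w by blast
      then have sum_w: "(\<Sum>b\<in>V. \<phi> b \<bullet> w) = 0"
        using \<eta>_sum[of w] by simp
      have "\<forall>b\<in>V. \<phi> b \<bullet> w = 0"
      proof (cases "n = 1")
        case True
        then obtain b where "V = {b}"
          using cardV by (auto simp: card_1_singleton_iff)
        then show ?thesis
          using sum_w by simp
      next
        case False
        \<comment> \<open>With n \<noteq> 1, the coordinate -1 of \<open>v\<close> forces t = n + 1
          in \<open>step\<close>. A negative integer coordinate of \<open>w\<close> would then give
          a value of at most -(n + 1). Nonnegative coordinates with sum 0 vanish, so
          \<open>w\<close> would be the interior point 0.\<close>
        have "\<phi> b \<bullet> w \<ge> 0" if b: "b \<in> V" for b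
        proof -
          obtain k where k: "\<phi> b \<bullet> w = of_int k"
            using \<phi>_int[OF b w] by (auto elim: Ints_cases)
          have "(n + 1) * of_int k \<in> {-1, 0, n}"
            using step[OF b] v_coord[OF False b] n1 False w \<eta>w k by auto
          then have "(n + 1) * of_int k > (n + 1) * (-1)"
            using n1 by auto
          then have "real_of_int k > -1"
            using n1 by (subst (asm) mult_less_cancel_left_pos) auto
          then show ?thesis
            using k by simp
        qed
        then show ?thesis
          using finV sum_w by (subst (asm) sum_nonneg_eq_0_iff) auto
      qed
      then have "w = 0"
        by (subst rep) simp
      then show False
        using w P'(2) extreme_point_not_in_interior by (auto simp: vertices_def)
    qed
  qed
  then have verts: "vertices P = insert v V"
    using v VP by auto
  have "v \<notin> V"
    using v(2) \<eta>V n1 by force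
  then have card: "int (card (insert v V)) = int CARD('n) + 1"
    using finV cardV by (simp add: n_def)
  have hull: "P = convex hull insert v V"
    using polytope_convex_hull_vertices[OF P'(1)] verts by simp
  \<comment> \<open>Having n + 1 points with an affine hull of dimension n amounts to affine
    independence.\<close>
  have "aff_dim (insert v V) = int CARD('n)"
    using P hull by (metis aff_dim_convex_hull fano_polytope_def)
  then have "\<not> affine_dependent (insert v V)"
    using card finV by (simp add: affine_independent_iff_card)
  with card hull show ?thesis
    unfolding simplex_def by blast
qed

section \<open>The vertex sum and reduction to the extremal case\<close>

theorem theorem1p9:
  fixes P :: "(real ^ 'n) set"
  assumes "fano_polytope P"
    and "\<not> int CARD('n) simplex P"
  shows "\<exists>F. F facet_of P \<and>
    (\<Sum>v \<in> {v \<in> vertices P. facet_normal F \<bullet> v \<ge> 1}. facet_normal F \<bullet> v) \<le> real CARD('n) \<and>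
    (\<forall>v \<in> vertices P. integral_distance F v \<le> real CARD('n))"
proof (rule ccontr)
  note P' = fano_polytopeD[OF assms(1)]
  let ?n = "real CARD('n)"
  define S where "S F = {v \<in> vertices P. facet_normal F \<bullet> v \<ge> 1}" for F
  assume none: "\<not> ?thesis"
  have finS: "finite (S F)" for F
    using finite_vertices[OF P'(1)] by (simp add: S_def)
  have n1: "?n \<ge> 1"
    by (simp add: Suc_leI)
  \<comment> \<open>If the sum bound holds, the distance bound must fail at some \<open>v\<close>.
    Its value exceeds n - 1 and is an integer, hence is at least n.\<close>
  have big: "\<exists>v\<in>S F. facet_normal F \<bullet> v \<ge> ?n"
    if F: "F facet_of P" and le: "(\<Sum>v\<in>S F. facet_normal F \<bullet> v) \<le> ?n" for F
  proof -
    obtain v where v: "v \<in> vertices P" "facet_normal F \<bullet> v + 1 > ?n"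
      using none F le by (auto simp: S_def integral_distance_def not_le)
    moreover have "facet_normal F \<bullet> v \<in> \<int>"
      using facet_normal_inner_Ints[OF assms(1) F] P'(3) v(1) by auto
    then obtain k where k: "facet_normal F \<bullet> v = of_int k"
      by (auto elim: Ints_cases)
    then have "k \<ge> int CARD('n)"
      using v(2) by linarith
    then have "facet_normal F \<bullet> v \<ge> ?n"
      unfolding k by linarith
    moreover from this n1 have "facet_normal F \<bullet> v \<ge> 1"
      by linarith
    ultimately show ?thesis
      by (auto simp: S_def)
  qed
  have le_sum: "facet_normal F \<bullet> v \<le> (\<Sum>v\<in>S F. facet_normal F \<bullet> v)" if "v \<in> S F" for F v
    using that finS by (intro member_le_sum) (auto simp: S_def)
  note sum_S = sum_vertices_facet_normal[OF assms(1), folded S_def]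
  \<comment> \<open>Otherwise some facet has positive values of total less than n, leaving no room
    for the value that \<open>big\<close> provides.\<close>
  have zero: "(\<Sum>v\<in>vertices P. v) = 0"
  proof (rule ccontr)
    assume "(\<Sum>v\<in>vertices P. v) \<noteq> 0"
    then obtain F where F: "F facet_of P" "facet_normal F \<bullet> (\<Sum>v\<in>vertices P. v) < 0"
      using facet_in_direction[OF P'(1,2)] by metis
    then show False
      using big[OF F(1)] sum_S[OF F(1)] le_sum by force
  qed
  have "\<exists>v\<in>vertices P. facet_normal F \<bullet> v = ?n \<and>
      (\<forall>x\<in>vertices P - {v}. facet_normal F \<bullet> x \<in> {-1, 0})" if F: "F facet_of P" for F
  proof -
    let ?\<eta> = "facet_normal F"
    have sum_n: "(\<Sum>v\<in>S F. ?\<eta> \<bullet> v) = ?n"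
      using sum_S[OF F] zero by simp
    then obtain v where v: "v \<in> S F" "?\<eta> \<bullet> v = ?n"
      using big[OF F] le_sum by (metis order.antisym order.refl)
    \<comment> \<open>The value n at \<open>v\<close> already exhausts the total n; a second member
      of \<open>S F\<close> would add at least 1.\<close>
    have S: "x = v" if "x \<in> S F" for x
    proof (rule ccontr)
      assume "x \<noteq> v"
      then have "?\<eta> \<bullet> x + ?\<eta> \<bullet> v = (\<Sum>v\<in>{x, v}. ?\<eta> \<bullet> v)"
        by simp
      also have "\<dots> \<le> ?n"
        unfolding sum_n[symmetric] using that v(1) finS
        by (intro sum_mono2) (auto simp: S_def)
      finally show False
        using that v(2) by (simp add: S_def)
    qed
    have "?\<eta> \<bullet> x \<in> {-1, 0}" if x: "x \<in> vertices P - {v}" for x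
    proof -
      have "x \<in> P"
        using x by (auto simp: vertices_def extreme_point_of_def)
      then have "?\<eta> \<bullet> x \<ge> -1"
        using facet_normal_ex1(3)[OF P'(1,2) F] by blast
      moreover have "?\<eta> \<bullet> x < 1"
        using S x by (force simp: S_def)
      moreover have "?\<eta> \<bullet> x \<in> \<int>"
        using facet_normal_inner_Ints[OF assms(1) F] P'(3) x by auto
      ultimately show ?thesis
        by (auto elim!: Ints_cases)
    qed
    then show ?thesis
      using v by (auto simp: S_def)
  qed
  then show False
    using extremal_fano_polytope_simplex assms by blast
qed

end
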